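(* Let $\mu$ be an LJSD with $\xi\le1$. Then the limiting bias $B_\mu$ of random feature regression is a nonincreasing function of the overparameterization ratio $\phi/\psi$ (where $\phi$, $\gamma$, $\mu$, $\sigma$ are held fixed and $\psi>0$ varies).
   Context: Parameters: $\phi,\psi>0$, ridge constant $\gamma\ge0$. Activation $\sigma:\mathbb{R}\to\mathbb{R}$, differentiable almost everywhere with $|\sigma(u)|,|\sigma'(u)|\le c_0e^{c_1|u|}$ for constants $c_0,c_1$. LJSD: a limiting joint spectral distribution is a probability measure $\mu$ on $\mathbb{R}_+^2$, the law of a pair $(\lambda,r)$ (training eigenvalue, overlap coefficient of the test covariance), supported in $[0,C]^2$ for some $C$, either absolutely continuous or a finite sum of delta masses; $s=\mathbb{E}_\mu[\lambda]$ and $s_*=\mathbb{E}_\mu[r]$ are finite and positive. Constants: with $z\sim\mathcal N(0,s)$, $\eta=\mathbb{V}[\sigma(z)]$, $\rho=(\frac1s\mathbb{E}[z\sigma(z)])^2$, $\zeta=s\rho$, $\omega=s(\eta/\zeta-1)$ (assumed well defined); $\rho_*$ is defined as $\rho$ but with $s$ replaced by $s_*$; $\xi=\sqrt{\rho_*/\rho}$. Functionals: $\mathcal{I}_{a,b}(x)=\phi\,\mathbb{E}_\mu[\lambda^a(\phi+x\lambda)^{-b}]$, $\mathcal{I}^*_{a,b}(x)=\phi\,\mathbb{E}_\mu[r\lambda^{a-1}(\phi+x\lambda)^{-b}]$. Limiting bias: $B_\mu=(1-\xi)^2s_*+2(1-\xi)\xi\mathcal{I}^*_{1,1}(x)+\xi^2\phi\mathcal{I}^*_{1,2}(x)$,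 where $x$ is the unique nonnegative real root of $x=(1-\gamma\tau)/(\omega+\mathcal{I}_{1,1}(x))$, in which the product $\gamma\tau$ is given by $\gamma\tau=\frac{\sqrt{(\psi-\phi)^2+4x\psi\phi\gamma/\rho}+\psi-\phi}{2\psi}$ (so for $\gamma=0$ the equation reads $x=\min(1,\phi/\psi)/(\omega+\mathcal{I}_{1,1}(x))$). Here $\phi=\lim n_0/m$ and $\psi=\lim n_0/n_1$ for input dimension $n_0$, sample size $m$, number of random features $n_1$, so $\phi/\psi=\lim n_1/m$. *)

theory Defs
  imports "HOL-Probability.Probability"
begin

text \<open>
  Limiting quantities for random feature regression under covariate shift. Throughout, \<open>\<phi>\<close> and
  \<open>\<psi>\<close> are the limits of \<open>n0 / m\<close> and \<open>n0 / n1\<close> (input dimension, sample size, number of random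
  features), \<open>\<gamma>\<close> is the ridge constant, \<open>\<sigma>\<close> the activation, and \<open>\<mu>\<close> the joint law of
  \<open>(\<lambda>, r)\<close>, the training eigenvalue and the overlap coefficient of the test covariance; the bound
  variable \<open>l\<close> below stands for \<open>\<lambda>\<close>.
\<close>

section \<open>Activation function\<close>

definition admissible_activation :: "(real \<Rightarrow> real) \<Rightarrow> bool" where
  "admissible_activation \<sigma> \<longleftrightarrow>
     (\<exists>c0 c1. (\<forall>u. \<bar>\<sigma> u\<bar> \<le> c0 * exp (c1 * \<bar>u\<bar>)) \<and>
              (AE u in lborel. \<sigma> differentiable (at u) \<and>
                               \<bar>deriv \<sigma> u\<bar> \<le> c0 * exp (c1 * \<bar>u\<bar>)))"


section \<open>Limiting joint spectral distributions\<close>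

definition finite_delta_mass :: "(real \<times> real) measure \<Rightarrow> bool" where
  "finite_delta_mass \<mu> \<longleftrightarrow>
     (\<exists>A w. finite A \<and> (\<forall>p\<in>A. 0 \<le> w p) \<and>
        (\<forall>B\<in>sets borel. emeasure \<mu> B = (\<Sum>p\<in>A. ennreal (w p) * emeasure (return borel p) B)))"

definition train_scale :: "(real \<times> real) measure \<Rightarrow> real" where
  "train_scale \<mu> = (LINT (l, r)|\<mu>. l)"

definition test_scale :: "(real \<times> real) measure \<Rightarrow> real" where
  "test_scale \<mu> = (LINT (l, r)|\<mu>. r)"

text \<open>Finiteness of the two means is automatic, since the support is bounded.\<close>

definition LJSD :: "(real \<times> real) measure \<Rightarrow> bool" where
  "LJSD \<mu> \<longleftrightarrow>
     prob_space \<mu> \<and> sets \<mu> = sets borel \<and>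
     (\<exists>C. AE p in \<mu>. p \<in> {0..C} \<times> {0..C}) \<and>
     (absolutely_continuous lborel \<mu> \<or> finite_delta_mass \<mu>) \<and>
     train_scale \<mu> > 0 \<and> test_scale \<mu> > 0"


section \<open>Gaussian constants of the activation\<close>

text \<open>
  The law of \<open>z \<sim> N(0, v)\<close>; \<^const>\<open>normal_density\<close> takes the standard deviation. The
  measurable sets are the Lebesgue measurable ones because an almost everywhere
  differentiable function is Lebesgue but not necessarily Borel measurable.
\<close>

definition gauss :: "real \<Rightarrow> real measure" where
  "gauss v = density lebesgue (\<lambda>z. ennreal (normal_density 0 (sqrt v) z))"

definition rho_at :: "(real \<Rightarrow> real) \<Rightarrow> real \<Rightarrow> real" where
  "rho_at \<sigma> v = (1 / v * (LINT z|gauss v. z * \<sigma> z))\<^sup>2"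

definition eta :: "(real \<times> real) measure \<Rightarrow> (real \<Rightarrow> real) \<Rightarrow> real" where
  "eta \<mu> \<sigma> = prob_space.variance (gauss (train_scale \<mu>)) \<sigma>"

definition rho :: "(real \<times> real) measure \<Rightarrow> (real \<Rightarrow> real) \<Rightarrow> real" where
  "rho \<mu> \<sigma> = rho_at \<sigma> (train_scale \<mu>)"

definition rho_star :: "(real \<times> real) measure \<Rightarrow> (real \<Rightarrow> real) \<Rightarrow> real" where
  "rho_star \<mu> \<sigma> = rho_at \<sigma> (test_scale \<mu>)"

definition zeta :: "(real \<times> real) measure \<Rightarrow> (real \<Rightarrow> real) \<Rightarrow> real" where
  "zeta \<mu> \<sigma> = train_scale \<mu> * rho \<mu> \<sigma>"

definition omega :: "(real \<times> real) measure \<Rightarrow> (real \<Rightarrow> real) \<Rightarrow> real" where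
  "omega \<mu> \<sigma> = train_scale \<mu> * (eta \<mu> \<sigma> / zeta \<mu> \<sigma> - 1)"

definition xi :: "(real \<times> real) measure \<Rightarrow> (real \<Rightarrow> real) \<Rightarrow> real" where
  "xi \<mu> \<sigma> = sqrt (rho_star \<mu> \<sigma> / rho \<mu> \<sigma>)"


section \<open>Limiting bias\<close>

definition I_fun :: "(real \<times> real) measure \<Rightarrow> real \<Rightarrow> nat \<Rightarrow> nat \<Rightarrow> real \<Rightarrow> real" where
  "I_fun \<mu> \<phi> a b x = \<phi> * (LINT (l, r)|\<mu>. l ^ a / (\<phi> + x * l) ^ b)"

text \<open>The exponent of \<open>\<lambda>\<close> is \<open>a - 1\<close> as an integer, with value \<open>1\<close> for \<open>a = 1\<close> also at \<open>\<lambda> = 0\<close>.\<close>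

definition I_star :: "(real \<times> real) measure \<Rightarrow> real \<Rightarrow> nat \<Rightarrow> nat \<Rightarrow> real \<Rightarrow> real" where
  "I_star \<mu> \<phi> a b x = \<phi> * (LINT (l, r)|\<mu>. r * l powi (int a - 1) / (\<phi> + x * l) ^ b)"

text \<open>The product \<open>\<gamma>\<tau>\<close>, as a function of \<open>x\<close>.\<close>

definition gamma_tau ::
    "(real \<times> real) measure \<Rightarrow> (real \<Rightarrow> real) \<Rightarrow> real \<Rightarrow> real \<Rightarrow> real \<Rightarrow> real \<Rightarrow> real" where
  "gamma_tau \<mu> \<sigma> \<gamma> \<phi> \<psi> x =
     (sqrt ((\<psi> - \<phi>)\<^sup>2 + 4 * x * \<psi> * \<phi> * \<gamma> / rho \<mu> \<sigma>) + \<psi> - \<phi>) / (2 * \<psi>)"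

definition is_root ::
    "(real \<times> real) measure \<Rightarrow> (real \<Rightarrow> real) \<Rightarrow> real \<Rightarrow> real \<Rightarrow> real \<Rightarrow> real \<Rightarrow> bool" where
  "is_root \<mu> \<sigma> \<gamma> \<phi> \<psi> x \<longleftrightarrow>
     0 \<le> x \<and> x = (1 - gamma_tau \<mu> \<sigma> \<gamma> \<phi> \<psi> x) / (omega \<mu> \<sigma> + I_fun \<mu> \<phi> 1 1 x)"

definition the_root ::
    "(real \<times> real) measure \<Rightarrow> (real \<Rightarrow> real) \<Rightarrow> real \<Rightarrow> real \<Rightarrow> real \<Rightarrow> real" where
  "the_root \<mu> \<sigma> \<gamma> \<phi> \<psi> = (THE x. is_root \<mu> \<sigma> \<gamma> \<phi> \<psi> x)"

definition limiting_bias ::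
    "(real \<times> real) measure \<Rightarrow> (real \<Rightarrow> real) \<Rightarrow> real \<Rightarrow> real \<Rightarrow> real \<Rightarrow> real" where
  "limiting_bias \<mu> \<sigma> \<gamma> \<phi> \<psi> =
     (let x = the_root \<mu> \<sigma> \<gamma> \<phi> \<psi>; \<xi> = xi \<mu> \<sigma> in
       (1 - \<xi>)\<^sup>2 * test_scale \<mu> + 2 * (1 - \<xi>) * \<xi> * I_star \<mu> \<phi> 1 1 x
         + \<xi>\<^sup>2 * \<phi> * I_star \<mu> \<phi> 1 2 x)"

text \<open>
  The overparameterization ratios \<open>\<kappa> = \<phi> / \<psi>\<close>, i.e. \<open>\<psi> = \<phi> / \<kappa>\<close> with \<open>\<psi> > 0\<close>, at which the
  limiting bias is meaningful. For \<open>\<gamma> > 0\<close> or \<open>\<omega> > 0\<close> these are all positive ratios. In the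
  remaining case \<open>\<gamma> = 0\<close> and \<open>\<omega> = 0\<close> (a linear activation without ridge) the defining equation
  of \<open>x\<close> has no nonnegative root when \<open>min 1 \<kappa> \<ge> \<phi> \<cdot> \<mu>{\<lambda> > 0}\<close>, so such ratios are left out. Where it
  has a nonnegative root, the root is unique.
\<close>

definition ratios ::
    "(real \<times> real) measure \<Rightarrow> (real \<Rightarrow> real) \<Rightarrow> real \<Rightarrow> real \<Rightarrow> real set" where
  "ratios \<mu> \<sigma> \<gamma> \<phi> =
     {\<kappa>. 0 < \<kappa> \<and> (\<gamma> > 0 \<or> omega \<mu> \<sigma> > 0 \<or> (\<exists>x. is_root \<mu> \<sigma> \<gamma> \<phi> (\<phi> / \<kappa>) x))}"

end

theory Submission
  imports Defs
begin

text \<open>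
  Multiplied by its denominator, the equation for \<open>x\<close> reads \<open>\<omega> x + x I\<^sub>1\<^sub>,\<^sub>1(x) = 1 - \<gamma>\<tau>\<close>. Its left side
  is strictly increasing in \<open>x\<close> (\<open>\<omega> \<ge> 0\<close> by Cauchy--Schwarz) and its right side is nonincreasing,
  so a root is unique. For fixed \<open>x\<close> with \<open>1 - \<gamma>\<tau> \<ge> 0\<close>, which holds at a root,
  \<open>1 - \<gamma>\<tau>\<close> is nondecreasing in \<open>\<kappa> = \<phi> / \<psi>\<close>; hence the root grows with \<open>\<kappa>\<close>. The bias depends on
  \<open>\<kappa>\<close> only through the root, and for \<open>0 \<le> \<xi> \<le> 1\<close> it is a nonnegative combination of the
  functionals \<open>I\<^sup>*\<^sub>1\<^sub>,\<^sub>b\<close>, which are nonincreasing in \<open>x\<close>.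
\<close>

section \<open>Dependence of \<open>1 - \<gamma>\<tau>\<close> on the overparameterization ratio\<close>

text \<open>This is \<open>1 - \<gamma>\<tau>\<close> at \<open>\<psi> = \<phi> / \<kappa>\<close>,
  with \<open>c\<close> standing for \<open>\<gamma> / rho \<mu> \<sigma>\<close>. After this
  substitution \<open>\<phi>\<close> cancels.\<close>

definition gap :: "real \<Rightarrow> real \<Rightarrow> real \<Rightarrow> real" where
  "gap c \<kappa> x = (1 + \<kappa> - sqrt ((1 - \<kappa>)\<^sup>2 + 4 * \<kappa> * c * x)) / 2"

lemma one_minus_gamma_tau:
  assumes "\<phi> > 0" "\<kappa> > 0"
  shows "1 - gamma_tau \<mu> \<sigma> \<gamma> \<phi> (\<phi> / \<kappa>) x = gap (\<gamma> / rho \<mu> \<sigma>) \<kappa> x"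
proof -
  let ?D = "(1 - \<kappa>)\<^sup>2 + 4 * \<kappa> * (\<gamma> / rho \<mu> \<sigma>) * x"
  \<comment> \<open>If \<open>rho \<mu> \<sigma>\<close> is 0, both quotients by it take the default
    value 0, so the identity survives.\<close>
  have "(\<phi> / \<kappa> - \<phi>)\<^sup>2 + 4 * x * (\<phi> / \<kappa>) * \<phi> * \<gamma> / rho \<mu> \<sigma> = (\<phi> / \<kappa>)\<^sup>2 * ?D"
    using assms by (cases "rho \<mu> \<sigma> = 0") (simp_all add: field_simps power2_eq_square)
  then have "sqrt ((\<phi> / \<kappa> - \<phi>)\<^sup>2 + 4 * x * (\<phi> / \<kappa>) * \<phi> * \<gamma> / rho \<mu> \<sigma>) = \<phi> / \<kappa> * sqrt ?D"
    using assms by (simp add: real_sqrt_mult)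
  then have "gamma_tau \<mu> \<sigma> \<gamma> \<phi> (\<phi> / \<kappa>) x = (\<phi> / \<kappa> * sqrt ?D + \<phi> / \<kappa> - \<phi>) / (2 * (\<phi> / \<kappa>))"
    unfolding gamma_tau_def by presburger
  also have "\<dots> = (sqrt ?D + 1 - \<kappa>) / 2"
    using assms by (simp add: field_simps)
  finally show ?thesis
    unfolding gap_def by (simp add: field_simps)
qed

lemma gap_zero: "gap c \<kappa> 0 = min 1 \<kappa>"
  by (simp add: gap_def min_def abs_if)

lemma gap_antimono:
  assumes "c \<ge> 0" "\<kappa> > 0" "x \<le> y"
  shows "gap c \<kappa> y \<le> gap c \<kappa> x"
proof -
  have "4 * \<kappa> * c * x \<le> 4 * \<kappa> * c * y"
    using assms by (intro mult_left_mono) auto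
  then show ?thesis
    by (simp add: gap_def)
qed

lemma continuous_on_gap: "continuous_on A (gap c \<kappa>)"
  unfolding gap_def by (intro continuous_intros) simp

text \<open>\<open>gap c \<kappa> x\<close> is the smaller solution \<open>t\<close> of \<open>(1 - t) (\<kappa> - t) = \<kappa> c x\<close>.\<close>

lemma gap_eq:
  assumes "c \<ge> 0" "\<kappa> > 0" "x \<ge> 0"
  shows "(1 - gap c \<kappa> x) * (\<kappa> - gap c \<kappa> x) = \<kappa> * c * x"
proof -
  define S where "S = sqrt ((1 - \<kappa>)\<^sup>2 + 4 * \<kappa> * c * x)"
  have S: "S * S = (1 - \<kappa>)\<^sup>2 + 4 * \<kappa> * c * x"
    using assms unfolding S_def by simp
  have "(1 - gap c \<kappa> x) * (\<kappa> - gap c \<kappa> x) = (S * S - (1 - \<kappa>)\<^sup>2) / 4"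
    unfolding gap_def S_def[symmetric] by (simp add: field_simps power2_eq_square)
  then show ?thesis
    by (simp add: S)
qed

text \<open>The bounds put \<open>t\<close> left of the midpoint \<open>(1 + \<kappa>) / 2\<close>
  of the two solutions of the quadratic, so the square root can be compared with
  \<open>1 + \<kappa> - 2 * t\<close>.\<close>

lemma le_gapI:
  assumes "t \<le> 1" "t \<le> \<kappa>" "\<kappa> * c * x \<le> (1 - t) * (\<kappa> - t)"
  shows "t \<le> gap c \<kappa> x"
proof -
  have "(1 - \<kappa>)\<^sup>2 + 4 * \<kappa> * c * x \<le> (1 + \<kappa> - 2 * t)\<^sup>2"
    using assms(3) by (simp add: power2_eq_square algebra_simps)
  then have "sqrt ((1 - \<kappa>)\<^sup>2 + 4 * \<kappa> * c * x) \<le> 1 + \<kappa> - 2 * t"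
    using assms by (intro real_le_lsqrt) auto
  then show ?thesis
    by (simp add: gap_def)
qed

text \<open>Keep \<open>t = gap c \<kappa> x\<close> and raise \<open>\<kappa>\<close> in the
  quadratic: \<open>(1 - t) * (\<kappa> - t)\<close> grows at rate \<open>1 - t\<close> and
  \<open>\<kappa> * c * x\<close> at rate \<open>c * x\<close>. Since \<open>t\<close> is
  nonnegative, \<open>c * x \<le> 1 - t\<close>, and \<open>le_gapI\<close> applies at
  \<open>\<kappa>'\<close>.\<close>

lemma gap_mono_ratio:
  assumes "c \<ge> 0" "0 < \<kappa>" "\<kappa> \<le> \<kappa>'" "x \<ge> 0" "gap c \<kappa> x \<ge> 0"
  shows "gap c \<kappa> x \<le> gap c \<kappa>' x"
proof -
  define t where "t = gap c \<kappa> x"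
  have "t \<le> min 1 \<kappa>"
    using gap_antimono[of c \<kappa> 0 x] assms by (simp add: t_def gap_zero)
  then have t: "t \<le> 1" "t \<le> \<kappa>" "0 \<le> t"
    using assms by (auto simp: t_def)
  have eq: "(1 - t) * (\<kappa> - t) = \<kappa> * c * x"
    unfolding t_def using gap_eq assms by blast
  moreover have "(1 - t) * (\<kappa> - t) \<le> (1 - t) * \<kappa>"
    using t by (intro mult_left_mono) auto
  ultimately have "\<kappa> * (c * x) \<le> \<kappa> * (1 - t)"
    by (simp add: mult_ac)
  then have "c * x \<le> 1 - t"
    using assms by simp
  then have "(\<kappa>' - \<kappa>) * (c * x) \<le> (\<kappa>' - \<kappa>) * (1 - t)"
    using assms by (intro mult_left_mono) auto
  with eq have "\<kappa>' * c * x \<le> (1 - t) * (\<kappa>' - t)"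
    by (simp add: algebra_simps)
  with t assms have "t \<le> gap c \<kappa>' x"
    by (intro le_gapI) auto
  then show ?thesis
    by (simp add: t_def)
qed


section \<open>Gaussian moments\<close>

lemma prob_space_gauss:
  assumes "v > 0"
  shows "prob_space (gauss v)"
proof
  have "emeasure (gauss v) (space (gauss v)) = (\<integral>\<^sup>+z. ennreal (normal_density 0 (sqrt v) z) \<partial>lborel)"
    by (simp add: gauss_def emeasure_density nn_integral_completion measurable_completion)
  also have "\<dots> = 1"
    using assms by (simp add: nn_integral_eq_integral)
  finally show "emeasure (gauss v) (space (gauss v)) = 1" .
qed

lemma measurable_gauss_iff [simp]: "f \<in> borel_measurable (gauss v) \<longleftrightarrow> f \<in> borel_measurable lebesgue"
  by (simp add: gauss_def)

lemma integrable_gauss_iff: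
  fixes f :: "real \<Rightarrow> real"
  assumes [measurable]: "f \<in> borel_measurable borel"
  shows "integrable (gauss v) f \<longleftrightarrow> integrable lborel (\<lambda>z. normal_density 0 (sqrt v) z * f z)"
proof -
  have "integrable (gauss v) f \<longleftrightarrow> integrable lebesgue (\<lambda>z. normal_density 0 (sqrt v) z * f z)"
    unfolding gauss_def by (subst integrable_density) (auto intro: measurable_completion)
  then show ?thesis
    by (simp add: integrable_completion)
qed

lemma integral_gauss:
  fixes f :: "real \<Rightarrow> real"
  assumes [measurable]: "f \<in> borel_measurable borel"
  shows "(LINT z|gauss v. f z) = (LBINT z. normal_density 0 (sqrt v) z * f z)"
proof -
  have "(LINT z|gauss v. f z) = (LINT z|lebesgue. normal_density 0 (sqrt v) z * f z)"
    unfolding gauss_def by (subst integral_density) (auto intro: measurable_completion)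
  then show ?thesis
    by (simp add: integral_completion)
qed

lemma gauss_moments:
  assumes "v > 0"
  shows "integrable (gauss v) (\<lambda>z. z)" "integrable (gauss v) (\<lambda>z. z\<^sup>2)"
    "(LINT z|gauss v. z) = 0" "(LINT z|gauss v. z\<^sup>2) = v"
proof -
  have sd: "0 < sqrt v" and sd2: "(sqrt v)\<^sup>2 = v" using assms by simp_all
  show "integrable (gauss v) (\<lambda>z. z)"
    using integrable_normal_moment_nz_1[OF sd, of 0] by (subst integrable_gauss_iff) auto
  show "integrable (gauss v) (\<lambda>z. z\<^sup>2)"
    using integrable_normal_moment[OF sd, of 0 2] by (subst integrable_gauss_iff) auto
  show "(LINT z|gauss v. z) = 0"
    using integral_normal_moment_nz_1[OF sd, of 0] by (subst integral_gauss) auto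
  show "(LINT z|gauss v. z\<^sup>2) = v"
    using integral_normal_moment_even[OF sd, of 0 1] sd2
    by (subst integral_gauss) (auto simp: fact_numeral)
qed

text \<open>Completing the square absorbs the exponential into a Gaussian of variance
  \<open>2 * v\<close>, at the cost of \<open>exp (k\<^sup>2 * v)\<close>. The factor
  \<open>sqrt 2\<close> in \<open>?K\<close> is the ratio of the normalizing constants.\<close>

lemma integrable_gauss_exp_abs:
  assumes "v > 0"
  shows "integrable (gauss v) (\<lambda>z. exp (k * \<bar>z\<bar>))"
proof -
  let ?K = "sqrt 2 * exp (k\<^sup>2 * v)"
  have sqrt4: "sqrt (4 * pi * v) = sqrt 2 * sqrt (2 * pi * v)"
    by (simp flip: real_sqrt_mult)
  have bound: "normal_density 0 (sqrt v) z * exp (k * \<bar>z\<bar>)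
      \<le> ?K * normal_density 0 (sqrt (2 * v)) z" for z
  proof -
    have "0 \<le> (\<bar>z\<bar> - 2 * v * k)\<^sup>2 / (4 * v)"
      using assms by simp
    also have "\<dots> = (- z\<^sup>2 / (4 * v) + k\<^sup>2 * v) - (- z\<^sup>2 / (2 * v) + k * \<bar>z\<bar>)"
      using assms by (simp add: field_simps power2_eq_square)
    finally have "exp (- z\<^sup>2 / (2 * v) + k * \<bar>z\<bar>) \<le> exp (- z\<^sup>2 / (4 * v) + k\<^sup>2 * v)"
      by simp
    then have "exp (- z\<^sup>2 / (2 * v)) * exp (k * \<bar>z\<bar>) / sqrt (2 * pi * v)
        \<le> 1 / sqrt (2 * pi * v) * (exp (- z\<^sup>2 / (4 * v)) * exp (k\<^sup>2 * v))"
      using assms by (simp add: divide_right_mono flip: exp_add)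
    also have "1 / sqrt (2 * pi * v) = sqrt 2 * (1 / sqrt (4 * pi * v))"
      by (simp add: sqrt4)
    finally show ?thesis
      using assms by (simp add: normal_density_def mult_ac)
  qed
  have "integrable lborel (\<lambda>z. normal_density 0 (sqrt v) z * exp (k * \<bar>z\<bar>))"
  proof (rule Bochner_Integration.integrable_bound)
    show "integrable lborel (\<lambda>z. ?K * normal_density 0 (sqrt (2 * v)) z)"
      using assms by (intro integrable_mult_right) auto
    show "AE z in lborel. norm (normal_density 0 (sqrt v) z * exp (k * \<bar>z\<bar>))
        \<le> norm (?K * normal_density 0 (sqrt (2 * v)) z)"
      using bound by (simp add: abs_mult)
  qed simp
  then show ?thesis
    by (simp add: integrable_gauss_iff)
qed

text \<open>Cauchy--Schwarz: the variance of \<open>\<sigma> z\<close> dominates its part explained by \<open>z\<close>. Measurability of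
  \<open>\<sigma>\<close> off the origin comes from \<open>z \<mapsto> z * \<sigma> z\<close>, which must be integrable since
  its integral, otherwise the junk value \<open>0\<close>, makes \<open>\<zeta>\<close> nonzero.\<close>

lemma zeta_le_eta:
  assumes act: "admissible_activation \<sigma>" and s: "train_scale \<mu> > 0" and nz: "zeta \<mu> \<sigma> \<noteq> 0"
  shows "zeta \<mu> \<sigma> \<le> eta \<mu> \<sigma>"
proof -
  define s where "s = train_scale \<mu>"
  define M where "M = gauss s"
  define E where "E = (LINT z|M. z * \<sigma> z)"
  define m where "m = (LINT z|M. \<sigma> z)"
  have s0: "s > 0" using s by (simp add: s_def)
  interpret prob_space M
    unfolding M_def using s0 by (rule prob_space_gauss)
  have zeta: "zeta \<mu> \<sigma> = E\<^sup>2 / s"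
    using s0 by (simp add: zeta_def rho_def rho_at_def E_def M_def flip: s_def)
      (simp add: power2_eq_square)
  have eta: "eta \<mu> \<sigma> = (LINT z|M. (\<sigma> z - m)\<^sup>2)"
    by (simp add: eta_def m_def M_def s_def)
  obtain c0 c1 where bd: "\<And>u. \<bar>\<sigma> u\<bar> \<le> c0 * exp (c1 * \<bar>u\<bar>)"
    using act unfolding admissible_activation_def by blast
  have "E \<noteq> 0" using nz zeta by auto
  then have i_zs: "integrable M (\<lambda>z. z * \<sigma> z)"
    unfolding E_def using not_integrable_integral_eq by blast
  then have "(\<lambda>z. z * \<sigma> z) \<in> borel_measurable lebesgue"
    using borel_measurable_integrable by (fastforce simp: M_def)
  moreover have "(\<lambda>z::real. z) \<in> borel_measurable lebesgue"
    by (intro measurable_completion) simp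
  ultimately have "(\<lambda>z. z * \<sigma> z / z) \<in> borel_measurable lebesgue"
    by (rule borel_measurable_divide)
  \<comment> \<open>At 0 the quotient has the default value 0 and may differ from
    \<open>\<sigma>\<close>; changing one point keeps measurability.\<close>
  then have "\<sigma> \<in> borel_measurable lebesgue"
    by (rule measurable_discrete_difference[where X = "{0}"]) auto
  then have meas [measurable]: "\<sigma> \<in> borel_measurable M"
    by (simp add: M_def)
  have i_s2: "integrable M (\<lambda>z. (\<sigma> z)\<^sup>2)"
  proof (rule Bochner_Integration.integrable_bound)
    show "integrable M (\<lambda>z. c0\<^sup>2 * exp ((2 * c1) * \<bar>z\<bar>))"
      unfolding M_def using s0 by (intro integrable_mult_right integrable_gauss_exp_abs)
    have "(\<sigma> z)\<^sup>2 \<le> c0\<^sup>2 * exp ((2 * c1) * \<bar>z\<bar>)" for z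
    proof -
      have "(\<sigma> z)\<^sup>2 \<le> (c0 * exp (c1 * \<bar>z\<bar>))\<^sup>2"
        using bd[of z] power_mono[of "\<bar>\<sigma> z\<bar>" _ 2] by simp
      then show ?thesis
        by (simp add: power_mult_distrib mult_ac flip: exp_double)
    qed
    then show "AE z in M. norm ((\<sigma> z)\<^sup>2) \<le> norm (c0\<^sup>2 * exp ((2 * c1) * \<bar>z\<bar>))"
      by (simp add: abs_mult)
  qed measurable
  have i_s: "integrable M \<sigma>"
    using i_s2 by (rule square_integrable_imp_integrable[OF meas])
  note mom = gauss_moments[OF s0, folded M_def]
  \<comment> \<open>The least-squares slope of \<open>\<sigma> z\<close> on \<open>z\<close>. The
    mean squared residual is then \<open>eta \<mu> \<sigma> - zeta \<mu> \<sigma>\<close>.\<close>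
  define a where "a = E / s"
  have sq: "(\<sigma> z - m - a * z)\<^sup>2 = (\<sigma> z - m)\<^sup>2 - 2 * a * (z * \<sigma> z) + 2 * a * m * z + a\<^sup>2 * z\<^sup>2" for z
    by (simp add: power2_eq_square algebra_simps)
  have i_v: "integrable M (\<lambda>z. (\<sigma> z - m)\<^sup>2)"
    using i_s i_s2 by (simp add: power2_diff)
  have "0 \<le> (LINT z|M. (\<sigma> z - m - a * z)\<^sup>2)"
    by simp
  also have "\<dots> = eta \<mu> \<sigma> - 2 * a * E + a\<^sup>2 * s"
    unfolding sq eta E_def using i_v i_zs mom by simp
  also have "a\<^sup>2 * s = a * E"
    using s0 by (simp add: a_def power2_eq_square)
  finally have "a * E \<le> eta \<mu> \<sigma>"
    by (simp add: mult.commute)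
  then show ?thesis
    by (simp add: zeta a_def power2_eq_square)
qed

lemma omega_nonneg:
  assumes "admissible_activation \<sigma>" "train_scale \<mu> > 0" "zeta \<mu> \<sigma> \<noteq> 0"
  shows "omega \<mu> \<sigma> \<ge> 0"
proof -
  have "zeta \<mu> \<sigma> > 0"
    using assms by (simp add: zeta_def rho_def rho_at_def)
  then show ?thesis
    using zeta_le_eta[OF assms] assms by (simp add: omega_def)
qed


section \<open>The spectral integrals\<close>

locale bounded_spectral_law = prob_space \<mu> for \<mu> :: "(real \<times> real) measure" +
  fixes C \<phi> :: real
  assumes sets_eq [measurable_cong]: "sets \<mu> = sets borel"
    and support: "AE p in \<mu>. p \<in> {0..C} \<times> {0..C}"
    and train_scale_pos: "train_scale \<mu> > 0"
    and phi_pos: "\<phi> > 0"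
begin

lemma measurable_coords [measurable]: "fst \<in> borel_measurable \<mu>" "snd \<in> borel_measurable \<mu>"
  by (simp_all add: measurable_cong_sets[OF sets_eq refl] flip: borel_prod)

lemma integrable_fst: "integrable \<mu> fst"
  using support by (intro integrable_const_bound[where B = C]) auto

lemma train_scale_eq: "train_scale \<mu> = (LINT p|\<mu>. fst p)"
  by (simp add: train_scale_def split_beta')

text \<open>With \<open>x\<close> moved under the integral, the integrand is nondecreasing in
  \<open>x \<ge> 0\<close> and at most 1 for \<open>\<lambda> \<ge> 0\<close>, whereas the integrand
  of \<open>I_fun \<mu> \<phi> 1 1\<close> decreases.\<close>

definition H :: "real \<Rightarrow> real" where
  "H x = \<phi> * (LINT p|\<mu>. x * fst p / (\<phi> + x * fst p))"

lemma H_zero [simp]: "H 0 = 0"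
  by (simp add: H_def)

lemma H_eq: "x * I_fun \<mu> \<phi> 1 1 x = H x"
proof -
  have "(LINT p|\<mu>. x * fst p / (\<phi> + x * fst p)) = x * (LINT p|\<mu>. fst p / (\<phi> + x * fst p))"
    by (simp flip: integral_mult_right_zero)
  then show ?thesis
    by (simp add: I_fun_def H_def split_beta')
qed

lemma integrable_H:
  assumes "x \<ge> 0"
  shows "integrable \<mu> (\<lambda>p. x * fst p / (\<phi> + x * fst p))"
proof (rule integrable_const_bound[where B = 1])
  show "AE p in \<mu>. norm (x * fst p / (\<phi> + x * fst p)) \<le> 1"
    using support
  proof eventually_elim
    case (elim p)
    then have "0 \<le> x * fst p" using assms by (auto simp: mem_Times_iff)
    then show ?case using phi_pos by simp
  qed
qed measurable

lemma H_diff_integrand: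
  assumes "l \<ge> 0" "0 \<le> x" "0 \<le> y"
  shows "y * l / (\<phi> + y * l) - x * l / (\<phi> + x * l) = \<phi> * (y - x) * l / ((\<phi> + x * l) * (\<phi> + y * l))"
proof -
  have "\<phi> + x * l > 0" "\<phi> + y * l > 0"
    using assms phi_pos by (auto intro: add_pos_nonneg)
  then show ?thesis
    by (simp add: diff_frac_eq) (simp add: algebra_simps)
qed

text \<open>The difference of the integrands is nonnegative and vanishes only where
  \<open>\<lambda> = 0\<close>. Equality would thus force \<open>\<lambda> = 0\<close> almost
  surely, against the positive mean.\<close>

lemma H_less:
  assumes "0 \<le> x" "x < y"
  shows "H x < H y"
proof -
  let ?f = "\<lambda>p::real \<times> real. y * fst p / (\<phi> + y * fst p) - x * fst p / (\<phi> + x * fst p)"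
  have int: "integrable \<mu> ?f"
    using assms by (intro Bochner_Integration.integrable_diff integrable_H) auto
  have nn: "AE p in \<mu>. 0 \<le> ?f p \<and> (?f p = 0 \<longrightarrow> fst p = 0)"
    using support
  proof eventually_elim
    case (elim p)
    then have l: "0 \<le> fst p" by (auto simp: mem_Times_iff)
    then have "\<phi> + x * fst p > 0" "\<phi> + y * fst p > 0"
      using assms phi_pos by (auto intro: add_pos_nonneg)
    then show ?case
      using l assms phi_pos by (simp add: H_diff_integrand)
  qed
  have "(LINT p|\<mu>. ?f p) \<noteq> 0"
  proof
    assume "(LINT p|\<mu>. ?f p) = 0"
    then have "AE p in \<mu>. ?f p = 0"
      using int nn by (subst (asm) integral_nonneg_eq_0_iff_AE) auto
    with nn have "AE p in \<mu>. fst p = 0"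
      by eventually_elim auto
    then have "train_scale \<mu> = 0"
      unfolding train_scale_eq by (rule integral_eq_zero_AE)
    with train_scale_pos show False by simp
  qed
  moreover have "(LINT p|\<mu>. ?f p) \<ge> 0"
    using nn by (intro integral_nonneg_AE) auto
  ultimately have "\<phi> * (LINT p|\<mu>. ?f p) > 0"
    using phi_pos by simp
  also have "\<phi> * (LINT p|\<mu>. ?f p) = H y - H x"
    using assms by (simp add: H_def integrable_H right_diff_distrib)
  finally show ?thesis
    by simp
qed

lemma H_nonneg: "x \<ge> 0 \<Longrightarrow> H x \<ge> 0"
  using H_less[of 0 x] by (cases "x = 0") auto

text \<open>Both denominators in \<open>H_diff_integrand\<close> are at least \<open>\<phi>\<close>.
  The bound serves to make \<open>H\<close> continuous.\<close>

lemma H_lipschitz: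
  assumes "0 \<le> x" "x \<le> y"
  shows "H y - H x \<le> train_scale \<mu> * (y - x)"
proof -
  have "(LINT p|\<mu>. y * fst p / (\<phi> + y * fst p) - x * fst p / (\<phi> + x * fst p))
      \<le> (LINT p|\<mu>. (y - x) / \<phi> * fst p)"
  proof (rule integral_mono_AE)
    show "AE p in \<mu>. y * fst p / (\<phi> + y * fst p) - x * fst p / (\<phi> + x * fst p)
        \<le> (y - x) / \<phi> * fst p"
      using support
    proof eventually_elim
      case (elim p)
      then have l: "0 \<le> fst p" by (auto simp: mem_Times_iff)
      have "\<phi> * \<phi> \<le> (\<phi> + x * fst p) * (\<phi> + y * fst p)"
        using l assms phi_pos by (intro mult_mono) auto
      then have "\<phi> * (y - x) * fst p / ((\<phi> + x * fst p) * (\<phi> + y * fst p))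
          \<le> \<phi> * (y - x) * fst p / (\<phi> * \<phi>)"
        using l assms phi_pos by (intro divide_left_mono mult_pos_pos add_pos_nonneg) auto
      then show ?case
        using l assms phi_pos by (simp add: H_diff_integrand)
    qed
  qed (use assms in \<open>auto intro!: integrable_H integrable_fst\<close>)
  then have "\<phi> * ((LINT p|\<mu>. y * fst p / (\<phi> + y * fst p)) - (LINT p|\<mu>. x * fst p / (\<phi> + x * fst p)))
      \<le> \<phi> * ((y - x) / \<phi> * train_scale \<mu>)"
    using assms phi_pos by (intro mult_left_mono) (auto simp: integrable_H train_scale_eq)
  then show ?thesis
    using phi_pos by (simp add: H_def right_diff_distrib[of \<phi>] mult.commute)
qed

lemma continuous_on_H: "continuous_on {0..} H"
proof (rule lipschitz_on_continuous_on)
  have "dist (H x) (H y) \<le> train_scale \<mu> * dist x y" if "0 \<le> x" "x \<le> y" for x y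
    using H_lipschitz[OF that] H_less[of x y] that by (cases "x = y") (auto simp: dist_real_def)
  then show "(train_scale \<mu>)-lipschitz_on {0..} H"
    using train_scale_pos by (intro lipschitz_on_leI) auto
qed

text \<open>For positive \<open>x\<close> the sign is read off \<open>H x\<close>. At 0 this product
  vanishes, but there the functional is the mean \<open>train_scale \<mu>\<close>.\<close>

lemma I_fun_pos:
  assumes "x \<ge> 0"
  shows "I_fun \<mu> \<phi> 1 1 x > 0"
proof (cases "x = 0")
  case True
  then show ?thesis
    using phi_pos train_scale_pos by (simp add: I_fun_def train_scale_def split_beta')
next
  case False
  then have "0 < x * I_fun \<mu> \<phi> 1 1 x"
    unfolding H_eq using H_less[of 0 x] assms by simp
  then show ?thesis
    by (rule zero_less_mult_pos) (use False assms in simp)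
qed

text \<open>For exponent index 1 the power of \<open>\<lambda>\<close> is 1, so \<open>x\<close> and
  \<open>\<lambda>\<close> enter only through the denominator.\<close>

lemma I_star_antimono:
  assumes "0 \<le> x" "x \<le> y"
  shows "I_star \<mu> \<phi> 1 b y \<le> I_star \<mu> \<phi> 1 b x"
proof -
  have int: "integrable \<mu> (\<lambda>p. snd p / (\<phi> + z * fst p) ^ b)" if z: "z \<ge> 0" for z
  proof (rule integrable_const_bound[where B = "C / \<phi> ^ b"])
    show "AE p in \<mu>. norm (snd p / (\<phi> + z * fst p) ^ b) \<le> C / \<phi> ^ b"
      using support
    proof eventually_elim
      case (elim p)
      then have "0 \<le> z * fst p" "0 \<le> snd p" "snd p \<le> C" using z by (auto simp: mem_Times_iff)
      then show ?case
        using phi_pos by (auto simp: abs_mult intro!: frac_le power_mono)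
    qed
  qed measurable
  have "(LINT p|\<mu>. snd p / (\<phi> + y * fst p) ^ b) \<le> (LINT p|\<mu>. snd p / (\<phi> + x * fst p) ^ b)"
  proof (rule integral_mono_AE)
    show "AE p in \<mu>. snd p / (\<phi> + y * fst p) ^ b \<le> snd p / (\<phi> + x * fst p) ^ b"
      using support
    proof eventually_elim
      case (elim p)
      then have "0 \<le> snd p" "0 \<le> x * fst p" "x * fst p \<le> y * fst p"
        using assms by (auto simp: mem_Times_iff intro: mult_right_mono)
      then show ?case
        using phi_pos by (intro divide_left_mono mult_pos_pos zero_less_power power_mono) auto
    qed
  qed (use assms int in auto)
  then show ?thesis
    using phi_pos by (simp add: I_star_def split_beta')
qed

end


section \<open>The fixed-point equation\<close>

context bounded_spectral_law
begin

lemma is_root_iff: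
  assumes "omega \<mu> \<sigma> \<ge> 0" "\<kappa> > 0"
  shows "is_root \<mu> \<sigma> \<gamma> \<phi> (\<phi> / \<kappa>) x \<longleftrightarrow>
    0 \<le> x \<and> omega \<mu> \<sigma> * x + H x = gap (\<gamma> / rho \<mu> \<sigma>) \<kappa> x"
proof (cases "0 \<le> x")
  case True
  then have "omega \<mu> \<sigma> + I_fun \<mu> \<phi> 1 1 x > 0"
    using assms I_fun_pos by (intro add_nonneg_pos)
  then have "is_root \<mu> \<sigma> \<gamma> \<phi> (\<phi> / \<kappa>) x \<longleftrightarrow>
      0 \<le> x \<and> x * (omega \<mu> \<sigma> + I_fun \<mu> \<phi> 1 1 x) = gap (\<gamma> / rho \<mu> \<sigma>) \<kappa> x"
    unfolding is_root_def one_minus_gamma_tau[OF phi_pos assms(2)] by (simp only: eq_divide_eq) simp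
  then show ?thesis
    unfolding distrib_left H_eq by (simp only: mult.commute)
qed (simp add: is_root_def)

text \<open>At the root \<open>x\<close> the left side of the cleared equation is nonnegative, hence
  so is the gap, as \<open>gap_mono_ratio\<close> requires. Taking
  \<open>\<kappa> = \<kappa>'\<close> in both directions gives uniqueness.\<close>

lemma root_le:
  assumes om: "omega \<mu> \<sigma> \<ge> 0" and c: "\<gamma> / rho \<mu> \<sigma> \<ge> 0" and \<kappa>: "0 < \<kappa>" "\<kappa> \<le> \<kappa>'"
    and x: "is_root \<mu> \<sigma> \<gamma> \<phi> (\<phi> / \<kappa>) x" and y: "is_root \<mu> \<sigma> \<gamma> \<phi> (\<phi> / \<kappa>') y"
  shows "x \<le> y"
proof (rule ccontr)
  assume "\<not> x \<le> y"
  then have "y < x" by simp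
  have \<kappa>': "0 < \<kappa>'" using \<kappa> by simp
  note x = x[unfolded is_root_iff[OF om \<kappa>(1)]] and y = y[unfolded is_root_iff[OF om \<kappa>']]
  have "H x \<ge> 0" "omega \<mu> \<sigma> * x \<ge> 0" using x H_nonneg om by auto
  then have "gap (\<gamma> / rho \<mu> \<sigma>) \<kappa> x \<le> gap (\<gamma> / rho \<mu> \<sigma>) \<kappa>' x"
    using x by (intro gap_mono_ratio c \<kappa>) auto
  also have "\<dots> \<le> gap (\<gamma> / rho \<mu> \<sigma>) \<kappa>' y"
    using \<open>y < x\<close> by (intro gap_antimono c \<kappa>') auto
  finally have "omega \<mu> \<sigma> * x + H x \<le> omega \<mu> \<sigma> * y + H y"
    using x y by simp
  moreover have "omega \<mu> \<sigma> * y \<le> omega \<mu> \<sigma> * x"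
    using om \<open>y < x\<close> by (intro mult_left_mono) auto
  moreover have "H y < H x"
    using y \<open>y < x\<close> by (intro H_less) auto
  ultimately show False by simp
qed

lemma ex_root:
  assumes om: "omega \<mu> \<sigma> \<ge> 0" and c: "\<gamma> / rho \<mu> \<sigma> \<ge> 0" and \<kappa>: "0 < \<kappa>"
    and pos: "\<gamma> / rho \<mu> \<sigma> > 0 \<or> omega \<mu> \<sigma> > 0"
  shows "\<exists>x. is_root \<mu> \<sigma> \<gamma> \<phi> (\<phi> / \<kappa>) x"
proof -
  define c where "c = \<gamma> / rho \<mu> \<sigma>"
  note c = c[folded c_def] and pos = pos[folded c_def]
  define G where "G x = omega \<mu> \<sigma> * x + H x - gap c \<kappa> x" for x
  \<comment> \<open>If \<open>c > 0\<close>, the gap falls to 0 at \<open>1 / c\<close>. Otherwise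
    \<open>c = 0\<close>, and since the gap is at most 1, it suffices that
    \<open>omega \<mu> \<sigma> * X = 1\<close>.\<close>
  obtain X where X: "X \<ge> 0" "gap c \<kappa> X \<le> omega \<mu> \<sigma> * X"
  proof (cases "c > 0")
    case True
    have "(1 - \<kappa>)\<^sup>2 + 4 * \<kappa> * c * (1 / c) = (1 + \<kappa>)\<^sup>2"
      using True by (simp add: power2_eq_square algebra_simps)
    then have "gap c \<kappa> (1 / c) = 0"
      using \<kappa> unfolding gap_def by (simp only:) simp
    with True om show ?thesis
      by (intro that[of "1 / c"]) auto
  next
    case False
    then have om': "omega \<mu> \<sigma> > 0" using pos by auto
    have "gap c \<kappa> (1 / omega \<mu> \<sigma>) \<le> gap c \<kappa> 0"
      using om' by (intro gap_antimono c \<kappa>) auto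
    also have "\<dots> \<le> 1"
      by (simp add: gap_zero)
    finally show ?thesis
      using om' by (intro that[of "1 / omega \<mu> \<sigma>"]) auto
  qed
  have "G 0 \<le> 0" "0 \<le> G X"
    using X \<kappa> H_nonneg[of X] by (auto simp: G_def gap_zero)
  moreover have "continuous_on {0..X} G"
    unfolding G_def
    by (intro continuous_intros continuous_on_gap continuous_on_subset[OF continuous_on_H]) auto
  ultimately obtain x where "0 \<le> x" "G x = 0"
    using IVT'[of G 0 0 X] X by auto
  then have "is_root \<mu> \<sigma> \<gamma> \<phi> (\<phi> / \<kappa>) x"
    by (simp add: is_root_iff[OF om \<kappa>] G_def c_def)
  then show ?thesis ..
qed

end

theorem proposition5p3:
  fixes \<mu> :: "(real \<times> real) measure" and \<sigma> :: "real \<Rightarrow> real" and \<phi> \<gamma> :: real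
  assumes "\<phi> > 0" and "\<gamma> \<ge> 0"
    and "admissible_activation \<sigma>"
    and "LJSD \<mu>"
    and "zeta \<mu> \<sigma> \<noteq> 0"
    and "xi \<mu> \<sigma> \<le> 1"
  shows "antimono_on (ratios \<mu> \<sigma> \<gamma> \<phi>) (\<lambda>\<kappa>. limiting_bias \<mu> \<sigma> \<gamma> \<phi> (\<phi> / \<kappa>))"
proof -
  obtain C where "AE p in \<mu>. p \<in> {0..C} \<times> {0..C}"
    using assms(4) unfolding LJSD_def by blast
  then interpret bounded_spectral_law \<mu> C \<phi>
    using assms(1,4) by (simp add: bounded_spectral_law_def bounded_spectral_law_axioms_def LJSD_def)
  have om: "omega \<mu> \<sigma> \<ge> 0"
    using assms train_scale_pos by (intro omega_nonneg)
  have rho: "rho \<mu> \<sigma> > 0"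
    using assms(5) by (simp add: zeta_def rho_def rho_at_def)
  then have c: "\<gamma> / rho \<mu> \<sigma> \<ge> 0"
    using assms(2) by simp
  \<comment> \<open>The description in \<open>the_root\<close> is meaningful only under unique
    existence. Existence comes from \<open>ex_root\<close> if \<open>\<gamma> > 0\<close> or
    \<open>omega \<mu> \<sigma> > 0\<close>, and otherwise from the definition of
    \<open>ratios\<close>.\<close>
  have root: "is_root \<mu> \<sigma> \<gamma> \<phi> (\<phi> / \<kappa>) (the_root \<mu> \<sigma> \<gamma> \<phi> (\<phi> / \<kappa>))"
    if "\<kappa> \<in> ratios \<mu> \<sigma> \<gamma> \<phi>" for \<kappa>
  proof -
    have \<kappa>: "\<kappa> > 0" using that by (simp add: ratios_def)
    have "\<exists>x. is_root \<mu> \<sigma> \<gamma> \<phi> (\<phi> / \<kappa>) x"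
      using that ex_root[OF om c \<kappa>] rho by (auto simp: ratios_def)
    moreover have "x = y"
      if "is_root \<mu> \<sigma> \<gamma> \<phi> (\<phi> / \<kappa>) x" "is_root \<mu> \<sigma> \<gamma> \<phi> (\<phi> / \<kappa>) y" for x y
      using root_le[OF om c \<kappa> order_refl that] root_le[OF om c \<kappa> order_refl that(2,1)] by simp
    ultimately have "\<exists>!x. is_root \<mu> \<sigma> \<gamma> \<phi> (\<phi> / \<kappa>) x"
      by blast
    then show ?thesis
      unfolding the_root_def by (rule theI')
  qed
  have xi: "0 \<le> xi \<mu> \<sigma>" "0 \<le> 1 - xi \<mu> \<sigma>"
    using assms(6) rho by (simp_all add: xi_def rho_star_def rho_at_def)
  show ?thesis
  proof (rule monotone_onI)
    fix \<kappa> \<kappa>' assume \<kappa>: "\<kappa> \<in> ratios \<mu> \<sigma> \<gamma> \<phi>" "\<kappa>' \<in> ratios \<mu> \<sigma> \<gamma> \<phi>" "\<kappa> \<le> \<kappa>'"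
    let ?x = "the_root \<mu> \<sigma> \<gamma> \<phi> (\<phi> / \<kappa>)" and ?y = "the_root \<mu> \<sigma> \<gamma> \<phi> (\<phi> / \<kappa>')"
    have "0 \<le> ?x"
      using root[OF \<kappa>(1)] by (simp add: is_root_def)
    moreover have "?x \<le> ?y"
      using \<kappa>(1) by (intro root_le[OF om c _ \<kappa>(3) root root] \<kappa>) (simp add: ratios_def)
    ultimately have "I_star \<mu> \<phi> 1 b ?y \<le> I_star \<mu> \<phi> 1 b ?x" for b
      by (rule I_star_antimono)
    \<comment> \<open>Only the two \<open>I_star\<close> terms vary, and their coefficients are
      nonnegative because \<open>xi \<mu> \<sigma>\<close> lies between 0 and 1.\<close>
    then show "limiting_bias \<mu> \<sigma> \<gamma> \<phi> (\<phi> / \<kappa>') \<le> limiting_bias \<mu> \<sigma> \<gamma> \<phi> (\<phi> / \<kappa>)"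
      unfolding limiting_bias_def Let_def using xi phi_pos
      by (intro add_mono[OF add_left_mono] mult_left_mono) simp_all
  qed
qed

end
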